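(* Let $0<p<\infty$ and let $T$ be an infinite rooted tree such that the sequence $\{c_n\}$ is unbounded. Then there are no invertible multiplication operators from $\mathbb{T}_\infty$ to $\mathbb{T}_p$; that is, there is no $\psi:T\to\mathbb{C}$ such that $M_\psi:\mathbb{T}_\infty\to\mathbb{T}_p$ is an invertible operator.
   Context: Let $T$ be an infinite rooted tree with root $o$; $T$ also denotes its vertex set. For a vertex $v$, $|v|$ is the number of edges in the unique path from $o$ to $v$. For $n\in\mathbb{N}_0=\{0,1,2,\dots\}$, $D_n=\{v\in T:|v|=n\}$, and $c_n$ is the number of elements of $D_n$, assumed finite for each $n$ (so $1\le c_n<\infty$). For $f:T\to\mathbb{C}$ and $0<p<\infty$ put $M_p(n,f)=\left(\frac1{c_n}\sum_{|v|=n}|f(v)|^p\right)^{1/p}$, and $M_\infty(n,f)=\max_{|v|=n}|f(v)|$. For $0<p\le\infty$ put $\|f\|_p=\sup_{n\in\mathbb{N}_0}M_p(n,f)$ and $\mathbb{T}_p=\{f:T\to\mathbb{C}:\|f\|_p<\infty\}$. For $\psi:T\to\mathbb{C}$, $M_\psi f=\psi f$ (pointwise product). A linear operator $A:X\to Y$ is bounded if $\sup\{\|Af\|_Y/\|f\|_X: f\in X, f\neq0\}<\infty$; $M_\psi:X\to Y$ is invertible if it maps $X$ into $Y$, is bounded, and there is a bounded linear operator $B:Y\to X$ with $BM_\psi=I_X$ and $M_\psi B=I_Y$. *)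

theory Defs
  imports
    "HOL-Library.FuncSet"
    "HOL-Library.Extended_Real"
    "Graph_Theory.Digraph_Component"
begin

text \<open>
  An undirected simple graph, possibly infinite, is a symmetric loop-free relation on its vertex
  set. Back-and-forth walks u, v, u count as cycles of length 2 in Graph_Theory, so cycles in the
  undirected sense are those of length at least 3; for the same reason the predicate
  \<open>Digraph_Component.tree\<close> is not usable for symmetric digraphs.
\<close>

definition undirected_tree :: "'a pair_pre_digraph \<Rightarrow> bool" where
  "undirected_tree T \<longleftrightarrow>
     pair_bidirected_digraph T \<and>
     Digraph_Component.connected (with_proj T) \<and>
     \<not> (\<exists>es. pre_digraph.cycle (with_proj T) es \<and> 3 \<le> length es)"

definition rooted_tree :: "'a pair_pre_digraph \<Rightarrow> 'a \<Rightarrow> bool" where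
  "rooted_tree T r \<longleftrightarrow> undirected_tree T \<and> r \<in> pverts T"

definition depth :: "'a pair_pre_digraph \<Rightarrow> 'a \<Rightarrow> 'a \<Rightarrow> nat" where
  "depth T r v = length (THE es. pre_digraph.apath (with_proj T) r es v)"

definition level :: "'a pair_pre_digraph \<Rightarrow> 'a \<Rightarrow> nat \<Rightarrow> 'a set" where
  "level T r n = {v \<in> pverts T. depth T r v = n}"

text \<open>The exponent \<open>p\<close> ranges over the extended reals with \<open>0 < p\<close>.\<close>

definition M_mean :: "'a pair_pre_digraph \<Rightarrow> 'a \<Rightarrow> ereal \<Rightarrow> nat \<Rightarrow> ('a \<Rightarrow> complex) \<Rightarrow> real" where
  "M_mean T r p n f =
     (if p = \<infinity> then Max ((\<lambda>v. cmod (f v)) ` level T r n)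
      else (1 / real (card (level T r n)) *
             (\<Sum>v\<in>level T r n. cmod (f v) powr real_of_ereal p)) powr (1 / real_of_ereal p))"

definition T_norm :: "'a pair_pre_digraph \<Rightarrow> 'a \<Rightarrow> ereal \<Rightarrow> ('a \<Rightarrow> complex) \<Rightarrow> ereal" where
  "T_norm T r p f = (SUP n. ereal (M_mean T r p n f))"

text \<open>
  Complex functions on the vertex set are represented by their extensional representatives, so that
  equality of representatives is equality of functions on the vertex set.
\<close>

definition T_space :: "'a pair_pre_digraph \<Rightarrow> 'a \<Rightarrow> ereal \<Rightarrow> ('a \<Rightarrow> complex) set" where
  "T_space T r p = {f \<in> extensional (pverts T). T_norm T r p f < \<infinity>}"

definition mult_op ::
    "'a pair_pre_digraph \<Rightarrow> ('a \<Rightarrow> complex) \<Rightarrow> ('a \<Rightarrow> complex) \<Rightarrow> ('a \<Rightarrow> complex)" where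
  "mult_op T \<psi> f = (\<lambda>v\<in>pverts T. \<psi> v * f v)"

definition linear_operator ::
    "'a pair_pre_digraph \<Rightarrow> 'a \<Rightarrow> ereal \<Rightarrow> ereal \<Rightarrow> (('a \<Rightarrow> complex) \<Rightarrow> ('a \<Rightarrow> complex)) \<Rightarrow> bool" where
  "linear_operator T r p q A \<longleftrightarrow>
     A \<in> T_space T r p \<rightarrow> T_space T r q \<and>
     (\<forall>f\<in>T_space T r p. \<forall>g\<in>T_space T r p.
        A (\<lambda>v\<in>pverts T. f v + g v) = (\<lambda>v\<in>pverts T. A f v + A g v)) \<and>
     (\<forall>f\<in>T_space T r p. \<forall>c.
        A (\<lambda>v\<in>pverts T. c * f v) = (\<lambda>v\<in>pverts T. c * A f v))"

definition bounded_operator ::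
    "'a pair_pre_digraph \<Rightarrow> 'a \<Rightarrow> ereal \<Rightarrow> ereal \<Rightarrow> (('a \<Rightarrow> complex) \<Rightarrow> ('a \<Rightarrow> complex)) \<Rightarrow> bool" where
  "bounded_operator T r p q A \<longleftrightarrow>
     linear_operator T r p q A \<and>
     (SUP f \<in> {f \<in> T_space T r p. f \<noteq> (\<lambda>v\<in>pverts T. 0)}. T_norm T r q (A f) / T_norm T r p f) < \<infinity>"

definition invertible_mult_op ::
    "'a pair_pre_digraph \<Rightarrow> 'a \<Rightarrow> ereal \<Rightarrow> ereal \<Rightarrow> ('a \<Rightarrow> complex) \<Rightarrow> bool" where
  "invertible_mult_op T r p q \<psi> \<longleftrightarrow>
     bounded_operator T r p q (mult_op T \<psi>) \<and>
     (\<exists>B. bounded_operator T r q p B \<and>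
        (\<forall>f\<in>T_space T r p. B (mult_op T \<psi> f) = f) \<and>
        (\<forall>g\<in>T_space T r q. mult_op T \<psi> (B g) = g))"

end

theory Submission
  imports Defs
begin

text \<open>
  The constant function 1 lies in \<open>T_space T r \<infinity>\<close>, so \<open>\<psi>\<close> itself lies in \<open>T_space T r p\<close>. The
  indicator of a vertex \<open>v\<close> of level \<open>n\<close> has \<open>p\<close>-norm \<open>c\<^sub>n powr (-1/p)\<close>, and a bounded inverse must
  send it to a function with value \<open>1 / \<psi> v\<close> at \<open>v\<close>; hence \<open>cmod (\<psi> v) powr p\<close> is at least a
  constant times \<open>c\<^sub>n\<close>. Averaging over the level bounds \<open>c\<^sub>n\<close>.
\<close>

definition vertex_indicator :: "'a pair_pre_digraph \<Rightarrow> 'a \<Rightarrow> 'a \<Rightarrow> complex" where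
  "vertex_indicator T v = (\<lambda>w\<in>pverts T. if w = v then 1 else 0)"

lemma M_mean_le_T_norm: "ereal (M_mean T r p n f) \<le> T_norm T r p f"
  unfolding T_norm_def by (rule SUP_upper) simp

text \<open>Finiteness of the level makes \<open>Max\<close> a true upper bound for the values on
  it. This is how a norm bound on the image under the inverse becomes a bound at one vertex.\<close>

lemma cmod_le_T_norm_infinity:
  assumes "finite (level T r n)" "v \<in> level T r n"
  shows "ereal (cmod (f v)) \<le> T_norm T r \<infinity> f"
proof -
  have "cmod (f v) \<le> M_mean T r \<infinity> n f"
    using assms by (simp add: M_mean_def)
  then show ?thesis
    using M_mean_le_T_norm[of T r \<infinity> n f] by (meson ereal_less_eq(3) order_trans)
qed

lemma one_in_T_space_infinity: "(\<lambda>v\<in>pverts T. 1) \<in> T_space T r \<infinity>"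
proof -
  \<comment> \<open>\<open>Max {}\<close> covers the junk value of \<open>M_mean\<close> on an empty level.\<close>
  have "M_mean T r \<infinity> n (\<lambda>v\<in>pverts T. 1) \<le> max 1 (Max {})" for n
  proof (cases "level T r n = {}")
    case False
    have "(\<lambda>v. cmod ((\<lambda>v\<in>pverts T. 1) v)) ` level T r n = (\<lambda>v. 1) ` level T r n"
      by (rule image_cong) (auto simp: level_def)
    also have "\<dots> = {1}"
      using False by auto
    finally show ?thesis
      by (simp add: M_mean_def)
  qed (simp add: M_mean_def)
  then have "T_norm T r \<infinity> (\<lambda>v\<in>pverts T. 1) \<le> ereal (max 1 (Max {}))"
    unfolding T_norm_def by (intro SUP_least) (simp only: ereal_less_eq)
  also have "\<dots> < \<infinity>"
    by (simp only: less_ereal.simps)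
  finally show ?thesis
    by (simp add: T_space_def)
qed

lemma M_mean_vertex_indicator:
  assumes "finite (level T r m)" "v \<in> level T r n" "0 < p"
  shows "M_mean T r (ereal p) m (vertex_indicator T v) =
    (if m = n then (1 / real (card (level T r n))) powr (1 / p) else 0)"
proof -
  have "(\<Sum>w\<in>level T r m. cmod (vertex_indicator T v w) powr p) =
      (\<Sum>w\<in>level T r m. if w = v then 1 else 0)"
    using assms(3) by (intro sum.cong) (auto simp: vertex_indicator_def level_def)
  also have "\<dots> = (if v \<in> level T r m then 1 else 0)"
    using assms(1) by simp
  also have "\<dots> = (if m = n then 1 else 0)"
    using assms(2) by (auto simp: level_def)
  finally show ?thesis
    by (simp add: M_mean_def)
qed

text \<open>The supremum is attained at level \<open>n\<close>, the only level containing
  \<open>v\<close>; the means at all other levels vanish. On a large level the norm is small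
  although the value at \<open>v\<close> is 1.\<close>

lemma T_norm_vertex_indicator:
  assumes "\<And>m. finite (level T r m)" "v \<in> level T r n" "0 < p"
  shows "T_norm T r (ereal p) (vertex_indicator T v) =
    ereal ((1 / real (card (level T r n))) powr (1 / p))"
proof (rule antisym)
  show "T_norm T r (ereal p) (vertex_indicator T v) \<le>
      ereal ((1 / real (card (level T r n))) powr (1 / p))"
    unfolding T_norm_def
    by (intro SUP_least) (simp add: M_mean_vertex_indicator[OF assms])
  show "ereal ((1 / real (card (level T r n))) powr (1 / p)) \<le>
      T_norm T r (ereal p) (vertex_indicator T v)"
    using M_mean_le_T_norm[of T r "ereal p" n "vertex_indicator T v"]
    by (simp add: M_mean_vertex_indicator[OF assms])
qed

text \<open>Passes from a supremum of \<open>ereal\<close> quotients to an inequality between reals.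
  A real lower bound \<open>a\<close> for the norm of the image is enough, so that norm need not be
  computed.\<close>

lemma bounded_operatorE:
  assumes "bounded_operator T r p q A"
  obtains s where "0 < s"
    "\<And>f a b. \<lbrakk>f \<in> T_space T r p; f \<noteq> (\<lambda>v\<in>pverts T. 0); 0 < b; T_norm T r p f = ereal b;
      ereal a \<le> T_norm T r q (A f)\<rbrakk> \<Longrightarrow> a \<le> s * b"
proof -
  define F where "F = {f \<in> T_space T r p. f \<noteq> (\<lambda>v\<in>pverts T. 0)}"
  define S where "S = (SUP f \<in> F. T_norm T r q (A f) / T_norm T r p f)"
  have "S < \<infinity>"
    using assms by (simp add: bounded_operator_def S_def F_def)
  \<comment> \<open>\<open>S\<close> may fail to be positive, and is \<open>-\<infinity>\<close>
    when \<open>F\<close> is empty; a positive real bound is chosen so that later steps can divide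
    by the constant.\<close>
  then obtain s where s: "0 < s" "S \<le> ereal s"
  proof (cases S)
    case (real t)
    then show thesis
      by (intro that[of "max t 1"]) auto
  qed (use that[of 1] in auto)
  show thesis
  proof
    show "0 < s"
      by (fact s(1))
    fix f a b
    assume f: "f \<in> T_space T r p" "f \<noteq> (\<lambda>v\<in>pverts T. 0)" and b: "0 < b" "T_norm T r p f = ereal b"
      and a: "ereal a \<le> T_norm T r q (A f)"
    have "ereal (a / b) \<le> T_norm T r q (A f) / ereal b"
      using ereal_divide_right_mono[OF a, of "ereal b"] b(1) by simp
    also have "\<dots> \<le> S"
      unfolding S_def b(2)[symmetric] using f by (intro SUP_upper) (simp add: F_def)
    also have "\<dots> \<le> ereal s"
      by (fact s(2))
    finally show "a \<le> s * b"
      using b(1) by (simp add: divide_le_eq)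
  qed
qed

lemma card_level_le_of_bounded_inverse:
  assumes fin: "\<And>m. finite (level T r m)" and p: "0 < p"
    and B: "bounded_operator T r (ereal p) \<infinity> B"
      "\<And>g. g \<in> T_space T r (ereal p) \<Longrightarrow> mult_op T \<psi> (B g) = g"
  obtains s where "0 < s"
    "\<And>n v. v \<in> level T r n \<Longrightarrow> real (card (level T r n)) \<le> s * cmod (\<psi> v) powr p"
proof -
  obtain s where s: "0 < s"
    "\<And>f a b. \<lbrakk>f \<in> T_space T r (ereal p); f \<noteq> (\<lambda>v\<in>pverts T. 0); 0 < b;
      T_norm T r (ereal p) f = ereal b; ereal a \<le> T_norm T r \<infinity> (B f)\<rbrakk> \<Longrightarrow> a \<le> s * b"
    using bounded_operatorE[OF B(1)] by blast
  show thesis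
  proof
    show "0 < s powr p"
      using s(1) by simp
    fix n v assume v: "v \<in> level T r n"
    define e where "e = vertex_indicator T v"
    define c where "c = real (card (level T r n))"
    have vT: "v \<in> pverts T"
      using v by (simp add: level_def)
    have c: "0 < c"
      using v fin by (auto simp: c_def card_gt_0_iff)
    have norm: "T_norm T r (ereal p) e = ereal ((1 / c) powr (1 / p))"
      unfolding e_def c_def using fin v p by (rule T_norm_vertex_indicator)
    have e: "e \<in> T_space T r (ereal p)"
      using norm by (simp add: T_space_def) (simp add: e_def vertex_indicator_def)
    have "e v \<noteq> (\<lambda>v\<in>pverts T. 0) v"
      using vT by (simp add: e_def vertex_indicator_def)
    then have "e \<noteq> (\<lambda>v\<in>pverts T. 0)"
      by metis
    then have Be: "cmod (B e v) \<le> s * (1 / c) powr (1 / p)"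
      using e c norm cmod_le_T_norm_infinity[OF fin v] by (intro s(2)) auto
    \<comment> \<open>The right-inverse identity, read at \<open>v\<close>: it forces
      \<open>\<psi> v\<close> to be nonzero and \<open>B e v\<close> to be its reciprocal.\<close>
    have "mult_op T \<psi> (B e) v = 1"
      using B(2)[OF e] vT by (simp add: e_def vertex_indicator_def)
    then have "1 = cmod (\<psi> v) * cmod (B e v)"
      using vT by (simp add: mult_op_def flip: norm_mult)
    also have "\<dots> \<le> cmod (\<psi> v) * (s * (1 / c) powr (1 / p))"
      using Be by (rule mult_left_mono) simp
    finally have "1 powr p \<le> (cmod (\<psi> v) * (s * (1 / c) powr (1 / p))) powr p"
      using p by (intro powr_mono2) auto
    also have "\<dots> = s powr p * cmod (\<psi> v) powr p / c"
      using c s(1) p by (simp add: powr_mult powr_powr)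
    finally show "real (card (level T r n)) \<le> s powr p * cmod (\<psi> v) powr p"
      using c by (simp add: c_def le_divide_eq)
  qed
qed

theorem theorem12:
  fixes T :: "'a pair_pre_digraph" and r :: 'a and p :: real
  assumes "rooted_tree T r"
    and "infinite (pverts T)"
    and "\<And>n. finite (level T r n)"
    and "\<not> bdd_above (range (\<lambda>n. card (level T r n)))"
    and "0 < p"
  shows "\<not> (\<exists>\<psi> :: 'a \<Rightarrow> complex. invertible_mult_op T r \<infinity> (ereal p) \<psi>)"
proof
  assume "\<exists>\<psi> :: 'a \<Rightarrow> complex. invertible_mult_op T r \<infinity> (ereal p) \<psi>"
  then obtain \<psi> B where M: "bounded_operator T r \<infinity> (ereal p) (mult_op T \<psi>)"
    and B: "bounded_operator T r (ereal p) \<infinity> B"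
      "\<And>g. g \<in> T_space T r (ereal p) \<Longrightarrow> mult_op T \<psi> (B g) = g"
    unfolding invertible_mult_op_def by blast
  obtain s where s: "0 < s"
    "\<And>n v. v \<in> level T r n \<Longrightarrow> real (card (level T r n)) \<le> s * cmod (\<psi> v) powr p"
    using card_level_le_of_bounded_inverse[OF assms(3,5) B] by blast
  \<comment> \<open>The extensional representative of \<open>\<psi>\<close>, which itself is
    arbitrary off the vertex set.\<close>
  define g where "g = mult_op T \<psi> (\<lambda>v\<in>pverts T. 1)"
  have "g \<in> T_space T r (ereal p)"
    using M one_in_T_space_infinity[of T r]
    unfolding bounded_operator_def linear_operator_def g_def by blast
  then have "T_norm T r (ereal p) g < \<infinity>"
    by (simp add: T_space_def)
  then obtain K where K: "\<And>n. M_mean T r (ereal p) n g \<le> K"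
    using M_mean_le_T_norm[of T r "ereal p" _ g]
    by (cases "T_norm T r (ereal p) g") auto
  have "real (card (level T r n)) \<le> s * K powr p" for n
  proof (cases "level T r n = {}")
    case False
    define c where "c = real (card (level T r n))"
    define A where "A = 1 / c * (\<Sum>v\<in>level T r n. cmod (g v) powr p)"
    have c: "0 < c"
      using False assms(3) by (simp add: c_def card_gt_0_iff)
    \<comment> \<open>Each of the \<open>c\<close> terms of the level sum is at least
      \<open>c / s\<close>, hence so is their average \<open>A\<close>.\<close>
    have "c * (c / s) = (\<Sum>v\<in>level T r n. c / s)"
      by (simp add: c_def)
    also have "\<dots> \<le> (\<Sum>v\<in>level T r n. cmod (g v) powr p)"
    proof (rule sum_mono)
      fix v assume v: "v \<in> level T r n"
      then have "g v = \<psi> v"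
        by (simp add: g_def mult_op_def level_def)
      then show "c / s \<le> cmod (g v) powr p"
        using s(2)[OF v] s(1) by (simp add: c_def divide_le_eq mult.commute)
    qed
    finally have "c / s \<le> A"
      using c by (simp add: A_def le_divide_eq mult.commute)
    \<comment> \<open>A side fact rather than a link of the chain: it makes the \<open>p\<close>-th
      power undo the \<open>p\<close>-th root in the next step.\<close>
    also have "0 \<le> A"
      using c by (simp add: A_def sum_nonneg)
    then have "A = (A powr (1 / p)) powr p"
      using assms(5) by (simp add: powr_powr)
    \<comment> \<open>\<open>A powr (1 / p)\<close> is the mean of \<open>g\<close> over level
      \<open>n\<close>.\<close>
    also have "\<dots> \<le> K powr p"
      using K[of n] assms(5) by (intro powr_mono2) (simp_all add: M_mean_def A_def c_def)
    finally show ?thesis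
      using s(1) by (simp add: c_def divide_le_eq mult.commute)
  qed (use s(1) in simp)
  \<comment> \<open>The unboundedness hypothesis speaks of natural numbers, so the real bound is
    rounded up.\<close>
  then have "card (level T r n) \<le> nat \<lceil>s * K powr p\<rceil>" for n
    by (meson of_nat_le_iff order_trans real_nat_ceiling_ge)
  then show False
    using assms(4) unfolding bdd_above_def by blast
qed

end
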